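(* Let $f(x)=\int_0^\infty\frac{\mathrm{e}^{-xp}}{p+1}\,dp$ for $\Re x>0$, continued analytically to $D=\mathbb{C}\setminus(-\infty,0]=\{x\in\mathbb{C}: x\ne0,\ \arg x\ne\pi\}$. Then for all $x\in D$ $$f(x)=\int_0^\infty\frac{\mathrm{e}\cdot\mathrm{e}^{-xp}}{\mathrm{e}-\mathrm{e}^{-p}}\,dp-\sum_{k=1}^{\infty}\int_0^\infty\frac{\mathrm{e}^{2^{-k}}\mathrm{e}^{-2^kxq}}{\mathrm{e}^{2^{-k}}+\mathrm{e}^{-q}}\,dq=\Phi(\mathrm{e}^{-1},1,x)-\sum_{k=1}^{\infty}\Phi(-\mathrm{e}^{-2^{-k}},1,2^kx)$$ (the integrals being understood, when $\Re x\le0$, by analytic continuation in $x$). This implies $$f(x)=\sum_{m=1}^{\infty}\frac{(-1)^{m+1}\,\mathrm{e}\,\Gamma(m)}{(\mathrm{e}-1)^m(x)_m}-\sum_{k=1}^{\infty}\sum_{m=1}^{\infty}\frac{\Gamma(m)\,\mathrm{e}^{2^{-k}}}{(\mathrm{e}^{2^{-k}}+1)^m(2^kx)_m}.$$ The remainders $R_n$, $R_{kn}$ defined in the context satisfy: (a) for fixed $x\in D$, $R_n=O\big((\mathrm{e}-1)^{-n}n^{-\Re x}\big)$; (b) for fixed $n$ and large $x$, $R_n=O(x^{-n})$; (c) for fixed $x\in D$, $R_{kn}=O\big(2^{-k}(1+\mathrm{e}^{2^{-k}})^{-n}n^{-2^k\Re x}\big)$; (d) for fixed $k,n$ and large $x$,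 $R_{kn}=O(2^{-k}x^{-n})$.
   Context: $(z)_m=z(z+1)\cdots(z+m-1)$ is the rising factorial. $\Phi(z,s,a)=\sum_{n=0}^\infty z^n/(n+a)^s$ is the Lerch transcendent. (In the source's convention $f(x)$ is denoted $\mathrm{e}^x\mathrm{Ei}(-x)$.) The remainders are, for $x\in D$, the differences between the individual integrals (continued analytically in $x$) and the first $n-1$ terms of their factorial series: $$R_n=\int_0^\infty\frac{\mathrm{e}\cdot\mathrm{e}^{-xp}}{\mathrm{e}-\mathrm{e}^{-p}}\,dp-\sum_{m=1}^{n-1}\frac{(-1)^{m+1}\mathrm{e}\,\Gamma(m)}{(\mathrm{e}-1)^m(x)_m},\qquad R_{kn}=-\int_0^\infty\frac{\mathrm{e}^{2^{-k}}\mathrm{e}^{-2^kxq}}{\mathrm{e}^{2^{-k}}+\mathrm{e}^{-q}}\,dq+\sum_{m=1}^{n-1}\frac{\Gamma(m)\mathrm{e}^{2^{-k}}}{(\mathrm{e}^{2^{-k}}+1)^m(2^kx)_m}.$$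
   Formalization: In (c), k is fixed as well as x (uniformity in k fails, e.g. x=1, n=2), so the constant may depend on k; in (b) and (d), large x means x→∞ in closed sectors |arg x| ≤ π−δ, since the remainders have poles at points of the negative real axis. *)

theory Defs
  imports "HOL-Complex_Analysis.Complex_Analysis" "HOL-Library.Landau_Symbols"
    "HOL-Real_Asymp.Real_Asymp"
begin

definition slit_plane :: "complex set" where
  "slit_plane = - \<real>\<^sub>\<le>\<^sub>0"

definition continues_integral :: "(complex \<Rightarrow> real \<Rightarrow> complex) \<Rightarrow> (complex \<Rightarrow> complex) \<Rightarrow> bool" where
  "continues_integral g F \<longleftrightarrow>
     F holomorphic_on slit_plane \<and> (\<forall>x. Re x > 0 \<longrightarrow> (g x has_integral F x) {0..})"

(* By continues_integral_unique below, the value at a point of slit_plane does not depend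
   on the choice made by SOME. *)
definition continued_integral :: "(complex \<Rightarrow> real \<Rightarrow> complex) \<Rightarrow> complex \<Rightarrow> complex" where
  "continued_integral g = (SOME F. continues_integral g F)"

definition f_integrand :: "complex \<Rightarrow> real \<Rightarrow> complex" where
  "f_integrand x p = exp (- x * of_real p) / (of_real p + 1)"

definition J_integrand :: "complex \<Rightarrow> real \<Rightarrow> complex" where
  "J_integrand x p = exp 1 * exp (- x * of_real p) / (exp 1 - exp (- of_real p))"

definition K_integrand :: "nat \<Rightarrow> complex \<Rightarrow> real \<Rightarrow> complex" where
  "K_integrand k x q =
     exp (1 / 2 ^ k) * exp (- (2 ^ k) * x * of_real q) / (exp (1 / 2 ^ k) + exp (- of_real q))"

definition laplace_f :: "complex \<Rightarrow> complex" where
  "laplace_f = continued_integral f_integrand"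

definition J_int :: "complex \<Rightarrow> complex" where
  "J_int = continued_integral J_integrand"

definition K_int :: "nat \<Rightarrow> complex \<Rightarrow> complex" where
  "K_int k = continued_integral (K_integrand k)"

definition lerch_phi :: "complex \<Rightarrow> complex \<Rightarrow> complex \<Rightarrow> complex" where
  "lerch_phi z s a = (\<Sum>n. z ^ n / (of_nat n + a) powr s)"

lemma summable_lerch_phi:
  fixes z a :: complex
  assumes "norm z < 1"
  shows "summable (\<lambda>n. z ^ n / (of_nat n + a) powr 1)"
proof (rule summable_comparison_test_ev)
  show "summable (\<lambda>n. norm z ^ n)"
    using assms by (simp add: summable_geometric)
  have "\<forall>\<^sub>F n in sequentially. real n \<ge> norm a + 1"
    by real_asymp
  then show "\<forall>\<^sub>F n in sequentially. norm (z ^ n / (of_nat n + a) powr 1) \<le> norm z ^ n"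
  proof eventually_elim
    case (elim n)
    have "real n - norm a \<le> norm (of_nat n + a)"
      using norm_diff_ineq[of "of_nat n" a] by simp
    then have *: "1 \<le> norm (of_nat n + a)"
      using elim by linarith
    then have "norm z ^ n / norm (of_nat n + a) \<le> norm z ^ n / 1"
      by (intro divide_left_mono) auto
    moreover have "(of_nat n + a) powr 1 = of_nat n + a"
      using * by (auto simp: powr_def)
    ultimately show ?case
      by (simp add: norm_divide norm_power)
  qed
qed

definition J_term :: "nat \<Rightarrow> complex \<Rightarrow> complex" where
  "J_term m x =
     (-1) ^ (m + 1) * exp 1 * Gamma (of_nat m) / ((exp 1 - 1) ^ m * pochhammer x m)"

definition K_term :: "nat \<Rightarrow> nat \<Rightarrow> complex \<Rightarrow> complex" where
  "K_term k m x =
     Gamma (of_nat m) * exp (1 / 2 ^ k) / ((exp (1 / 2 ^ k) + 1) ^ m * pochhammer (2 ^ k * x) m)"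

definition J_rem :: "nat \<Rightarrow> complex \<Rightarrow> complex" where
  "J_rem n x = J_int x - (\<Sum>m=1..<n. J_term m x)"

definition K_rem :: "nat \<Rightarrow> nat \<Rightarrow> complex \<Rightarrow> complex" where
  "K_rem k n x = - K_int k x + (\<Sum>m=1..<n. K_term k m x)"

(* Large x: the remainders have poles at nonpositive real points arbitrarily far out, so an
   estimate as x tends to infinity can only be uniform away from the negative real axis. *)
definition at_infinity_sector :: "real \<Rightarrow> complex filter" where
  "at_infinity_sector \<delta> = inf at_infinity (principal {x. \<bar>Arg x\<bar> \<le> pi - \<delta>})"

lemma continues_integral_unique:
  assumes "continues_integral g F" "continues_integral g G" "x \<in> slit_plane"
  shows "F x = G x"
proof -
  have eq: "slit_plane = - (complex_of_real ` {..0})"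
    by (auto simp: slit_plane_def complex_slot_left_eq complex_nonpos_Reals_iff)
  have op: "open slit_plane"
    unfolding slit_plane_def by (simp add: open_Compl)
  have conn: "connected slit_plane"
    unfolding eq by (intro starlike_imp_connected starlike_slotted_complex_plane_left)
  have sub: "{z. Re z > 0} \<subseteq> slit_plane"
    by (auto simp: slit_plane_def complex_nonpos_Reals_iff)
  show ?thesis
  proof (rule analytic_continuation_open[where f = F and g = G and s = "{z. Re z > 0}"
        and s' = slit_plane])
    show "open {z. Re z > 0}" by (simp add: open_halfspace_Re_gt)
    show "{z. Re z > 0} \<noteq> {}" by (auto intro!: exI[of _ 1])
    show "F z = G z" if "z \<in> {z. Re z > 0}" for z
      using that assms(1,2) unfolding continues_integral_def by (auto intro: has_integral_unique)
  qed (use op conn sub assms in \<open>auto simp: continues_integral_def\<close>)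
qed

end

theory Submission
  imports Defs
begin

text \<open>
  With \<open>u = exp (- y / 2 ^ k)\<close>, the identity \<open>2 / (1 - u\<^sup>2) = 1 / (1 - u) + 1 / (1 + u)\<close> telescopes to
  \<open>1 / y = 1 / (1 - exp (- y)) - (\<Sum>k\<ge>1. 2 ^ -k / (1 + exp (- y / 2 ^ k)))\<close>, uniformly in \<open>y > 0\<close>.
  Put \<open>y = p + 1\<close> and take Laplace transforms: by the geometric series each summand gives a Lerch
  series \<open>\<Sum>n. z ^ n / (n + a)\<close>, with \<open>z = exp (- 1)\<close>, \<open>a = x\<close> for the first term and
  \<open>z = - exp (- 1 / 2 ^ k)\<close>, \<open>a = 2 ^ k x\<close> for the others. These series are holomorphic on the slit plane,
  and summation by parts bounds the \<open>k\<close>-th one by \<open>O(2 ^ -k)\<close>, locally uniformly in \<open>x\<close>.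

  Iterated summation by parts is Euler's transformation; it produces the factorial series, with
  remainder after \<open>M\<close> terms equal to \<open>(- z / (1 - z)) ^ M\<close> times
  \<open>\<Sum>n. z ^ n M! / pochhammer (n + a) (M + 1)\<close>. For large \<open>M\<close> the Pochhammer symbols are smallest at
  \<open>n = 0\<close>, and Gauss's product for the Gamma function gives the order \<open>M powr (- Re a)\<close>;
  in a sector, \<open>|x + t| \<ge> s (|x| + t)\<close> for all \<open>t \<ge> 0\<close> gives the decay in \<open>x\<close>.
\<close>

section \<open>Euler's transformation of the Lerch series\<close>

lemma slit_plane_iff: "x \<in> slit_plane \<longleftrightarrow> - norm x < Re x"
proof -
  have "Re x = - norm x \<longleftrightarrow> Im x = 0 \<and> Re x \<le> 0"
  proof
    assume *: "Re x = - norm x"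
    then have "(Re x)\<^sup>2 = (Re x)\<^sup>2 + (Im x)\<^sup>2"
      by (metis cmod_power2 power2_minus)
    moreover have "Re x \<le> 0" unfolding * by simp
    ultimately show "Im x = 0 \<and> Re x \<le> 0" by simp
  next
    assume "Im x = 0 \<and> Re x \<le> 0"
    then show "Re x = - norm x" by (simp add: cmod_eq_Re)
  qed
  moreover have "- norm x \<le> Re x"
    using abs_Re_le_cmod[of x] by linarith
  ultimately show ?thesis
    by (auto simp: slit_plane_def complex_nonpos_Reals_iff)
qed

text \<open>Expanding squares, the deficit is
  \<open>(1 + \<kappa>) / 2 * (norm y - t)\<^sup>2\<close>. If \<kappa> is the cosine of an angle
  \<theta> in [0, \<pi>], the hypothesis keeps y at angle at least \<theta> from the negative axis,
  and the constant is sin (\<theta> / 2).\<close>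

lemma norm_add_nonneg_ge:
  fixes y :: complex
  assumes "- \<kappa> * norm y \<le> Re y" "\<bar>\<kappa>\<bar> \<le> 1" "t \<ge> 0"
  shows "sqrt ((1 - \<kappa>) / 2) * (norm y + t) \<le> norm (y + of_real t)"
proof (rule power2_le_imp_le)
  have "(sqrt ((1 - \<kappa>) / 2) * (norm y + t))\<^sup>2 = (1 - \<kappa>) / 2 * (norm y + t)\<^sup>2"
    using assms by (simp add: power_mult_distrib)
  also have "\<dots> = (norm y)\<^sup>2 + t\<^sup>2 + 2 * t * (- \<kappa> * norm y) - (1 + \<kappa>) / 2 * (norm y - t)\<^sup>2"
    by (simp add: power2_eq_square field_simps)
  also have "\<dots> \<le> (norm y)\<^sup>2 + t\<^sup>2 + 2 * t * (- \<kappa> * norm y)"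
    using assms by simp
  also have "\<dots> \<le> (norm y)\<^sup>2 + t\<^sup>2 + 2 * t * Re y"
    using assms by (intro add_left_mono mult_left_mono) auto
  also have "\<dots> = (norm (y + of_real t))\<^sup>2"
    unfolding cmod_power2 by (simp add: power2_eq_square algebra_simps)
  finally show "(sqrt ((1 - \<kappa>) / 2) * (norm y + t))\<^sup>2 \<le> (norm (y + of_real t))\<^sup>2" .
qed simp

lemma open_slit_plane: "open slit_plane"
  unfolding slit_plane_def by (simp add: open_Compl)

lemma slit_plane_scale: "x \<in> slit_plane \<Longrightarrow> 2 ^ k * x \<in> slit_plane"
  using mult_strict_left_mono[of "- norm x" "Re x" "2 ^ k"]
  by (simp add: slit_plane_iff norm_mult norm_power)

lemma slit_plane_Re_pos: "Re x > 0 \<Longrightarrow> x \<in> slit_plane"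
  using norm_ge_zero[of x] by (simp add: slit_plane_iff del: norm_ge_zero)

text \<open>A neighbourhood of x still avoids a thin cone around the cut and a disc around 0. The
  bound is uniform in y and linear in t, as needed for majorants of series with denominators
  \<open>y + of_real t\<close>.\<close>

lemma slit_plane_local_bound:
  assumes "x \<in> slit_plane"
  obtains c d where "c > 0" "d > 0" "cball x d \<subseteq> slit_plane"
    "\<And>y t. y \<in> cball x d \<Longrightarrow> t \<ge> 0 \<Longrightarrow> c * (1 + t) \<le> norm (y + of_real t)"
proof -
  have x: "x \<noteq> 0" "- norm x < Re x"
    using assms by (auto simp: slit_plane_iff)
  then have "max 0 (- Re x / norm x) < 1"
    by (simp add: field_simps)
  \<comment> \<open>\<open>- Re x / norm x\<close> is the cosine of the angle between x and the
    negative axis. A strictly larger \<kappa> leaves room for a ball around x, and the maximum with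
    0 gives \<bar>\<kappa>\<bar> \<le> 1.\<close>
  then obtain \<kappa> where \<kappa>: "max 0 (- Re x / norm x) < \<kappa>" "\<kappa> < 1"
    using dense by blast
  define S where "S = {y. - \<kappa> * norm y < Re y} \<inter> {y. norm x / 2 < norm y}"
  have "open S"
    unfolding S_def by (intro open_Int open_Collect_less continuous_intros)
  moreover have "x \<in> S"
    using \<kappa> x by (auto simp: S_def field_simps)
  ultimately obtain d where d: "d > 0" "cball x d \<subseteq> S"
    by (meson open_contains_cball)
  \<comment> \<open>The first factor comes from the cone; the minimum turns
    \<open>norm y + t\<close> into a multiple of \<open>1 + t\<close>, since
    \<open>norm y > norm x / 2\<close> on S.\<close>
  define c where "c = sqrt ((1 - \<kappa>) / 2) * min 1 (norm x / 2)"
  show ?thesis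
  proof (rule that)
    show "c > 0" using \<kappa> x by (auto simp: c_def)
    show "d > 0" by fact
    show "cball x d \<subseteq> slit_plane"
    proof
      fix y assume "y \<in> cball x d"
      then have y: "- \<kappa> * norm y < Re y" "norm x / 2 < norm y" using d by (auto simp: S_def)
      have "- norm y \<le> - \<kappa> * norm y"
        using \<kappa> mult_right_mono[of \<kappa> 1 "norm y"] by auto
      with y show "y \<in> slit_plane" by (simp add: slit_plane_iff)
    qed
    fix y and t :: real assume "y \<in> cball x d" and t: "t \<ge> 0"
    then have y: "- \<kappa> * norm y < Re y" "norm x / 2 < norm y" using d by (auto simp: S_def)
    have "min 1 (norm x / 2) * (1 + t) \<le> norm y + t"
    proof -
      have "min 1 (norm x / 2) * t \<le> 1 * t"
        using t by (intro mult_right_mono) auto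
      then show ?thesis using y by (simp add: distrib_left)
    qed
    then have "c * (1 + t) \<le> sqrt ((1 - \<kappa>) / 2) * (norm y + t)"
      using \<kappa> unfolding c_def mult.assoc by (intro mult_left_mono) auto
    also have "\<dots> \<le> norm (y + of_real t)"
      using y \<kappa> t by (intro norm_add_nonneg_ge) auto
    finally show "c * (1 + t) \<le> norm (y + of_real t)" .
  qed
qed

section \<open>Tails of the Lerch series\<close>

lemma norm_pochhammer_ge:
  fixes a :: complex
  assumes "c \<ge> 0" "\<And>t. t \<ge> 0 \<Longrightarrow> c \<le> norm (a + of_real t)"
  shows "c ^ m \<le> norm (pochhammer (of_nat n + a) m)"
proof -
  have "c ^ m = (\<Prod>i<m. c)" by simp
  also have "\<dots> \<le> (\<Prod>i<m. norm (of_nat n + a + of_nat i))"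
  proof (rule prod_mono)
    fix i
    show "0 \<le> c \<and> c \<le> norm (of_nat n + a + of_nat i)"
      using assms(1) assms(2)[of "real (n + i)"] by (simp add: ac_simps)
  qed
  also have "\<dots> = norm (pochhammer (of_nat n + a) m)"
    by (simp add: pochhammer_prod prod_norm atLeast0LessThan)
  finally show ?thesis .
qed

text \<open>The coefficient \<open>fact m / pochhammer b (Suc m)\<close> is the m-th iterated
  difference of 1 / b, with the sign that makes it positive for b > 0. Hence m = 0 is the Lerch
  series itself, and m counts summations by parts.\<close>

definition lerch_tail :: "complex \<Rightarrow> nat \<Rightarrow> complex \<Rightarrow> complex" where
  "lerch_tail z m a = (\<Sum>n. z ^ n * fact m / pochhammer (of_nat n + a) (Suc m))"

lemma lerch_phi_eq_tail: "lerch_phi z 1 a = lerch_tail z 0 a"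
proof -
  \<comment> \<open>At w = 0 this is the convention \<open>0 powr 1 = 0\<close>, so both series also
    agree in a term with vanishing denominator.\<close>
  have "w powr 1 = w" for w :: complex
    by (cases "w = 0") (auto simp: powr_def)
  then show ?thesis by (simp add: lerch_phi_def lerch_tail_def)
qed

text \<open>A geometric majorant. The constant c is left open because it is chosen in three ways: a
  fixed power for summability, the Pochhammer symbol at n = 0 for large m, and a power of
  \<open>norm x\<close> for large x.\<close>

lemma lerch_tail_bound:
  assumes z: "norm z < 1" and c: "c > 0" "\<And>n. c \<le> norm (pochhammer (of_nat n + a) (Suc m))"
  shows "summable (\<lambda>n. z ^ n * fact m / pochhammer (of_nat n + a) (Suc m))"
    and "norm (lerch_tail z m a) \<le> fact m / c / (1 - norm z)"
proof -
  have *: "norm (z ^ n * fact m / pochhammer (of_nat n + a) (Suc m)) \<le> norm z ^ n * (fact m / c)" for n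
    using c(2)[of n] c(1) unfolding norm_mult norm_divide norm_power
    by (auto intro!: mult_left_mono divide_left_mono simp: zero_less_mult_iff simp flip: norm_mult)
  have s: "(\<lambda>n. norm z ^ n * (fact m / c)) sums (1 / (1 - norm z) * (fact m / c))"
    using z by (intro sums_mult2 geometric_sums) auto
  show "summable (\<lambda>n. z ^ n * fact m / pochhammer (of_nat n + a) (Suc m))"
    by (rule summable_comparison_test'[OF sums_summable[OF s] *])
  have "norm (lerch_tail z m a) \<le> (\<Sum>n. norm z ^ n * (fact m / c))"
    unfolding lerch_tail_def by (rule norm_suminf_le[OF * sums_summable[OF s]])
  also have "\<dots> = fact m / c / (1 - norm z)"
    using sums_unique[OF s] by (simp add: ac_simps)
  finally show "norm (lerch_tail z m a) \<le> fact m / c / (1 - norm z)" .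
qed

lemma summable_lerch_tail:
  assumes "norm z < 1" "a \<in> slit_plane"
  shows "summable (\<lambda>n. z ^ n * fact m / pochhammer (of_nat n + a) (Suc m))"
proof -
  obtain c d where c: "c > 0" "d > 0" "cball a d \<subseteq> slit_plane"
    "\<And>y t. y \<in> cball a d \<Longrightarrow> t \<ge> 0 \<Longrightarrow> c * (1 + t) \<le> norm (y + of_real t)"
    using slit_plane_local_bound[OF assms(2)] by blast
  have "c \<le> norm (a + of_real t)" if "t \<ge> 0" for t :: real
  proof -
    have "c * 1 \<le> c * (1 + t)" using c(1) that by (intro mult_left_mono) auto
    also have "\<dots> \<le> norm (a + of_real t)" using c(2) that by (intro c(4)) auto
    finally show ?thesis by simp
  qed
  from norm_pochhammer_ge[OF less_imp_le[OF c(1)] this] c(1) assms(1) show ?thesis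
    by (intro lerch_tail_bound(1)[of z "c ^ Suc m"]) (auto simp del: power_Suc)
qed

lemma slit_plane_add_of_nat_nonzero: "a \<in> slit_plane \<Longrightarrow> a + of_nat n \<noteq> 0"
  by (auto simp: slit_plane_def complex_nonpos_Reals_iff add_eq_0_iff2)

lemma pochhammer_slit_plane_nonzero: "a \<in> slit_plane \<Longrightarrow> pochhammer (of_nat n + a) m \<noteq> 0"
  using slit_plane_add_of_nat_nonzero[of a "n + i" for i]
  by (auto simp: pochhammer_prod ac_simps)

text \<open>Summation by parts; iterating this is Euler's transformation of the series.\<close>
lemma lerch_tail_rec:
  assumes z: "norm z < 1" and a: "a \<in> slit_plane"
  shows "(1 - z) * lerch_tail z m a = fact m / pochhammer a (Suc m) - z * lerch_tail z (Suc m) a"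
proof -
  define u where "u m n = (fact m / pochhammer (of_nat n + a) (Suc m) :: complex)" for m n
  have s: "(\<lambda>n. z ^ n * u m n) sums lerch_tail z m a" for m
    using summable_sums[OF summable_lerch_tail[OF z a, of m]] by (simp add: lerch_tail_def u_def)
  \<comment> \<open>One difference in n raises the order m by one; this is what summation by parts
    consumes.\<close>
  have diff: "u m n - u m (Suc n) = u (Suc m) n" for n
  proof -
    define b where "b = of_nat n + a"
    define P where "P = pochhammer (b + 1) m"
    have p1: "pochhammer b (Suc m) = b * P"
      by (simp only: pochhammer_rec P_def)
    have p2: "pochhammer (b + 1) (Suc m) = (b + 1 + of_nat m) * P"
      by (simp only: pochhammer_rec' P_def)
    have p3: "pochhammer b (Suc (Suc m)) = b * ((b + 1 + of_nat m) * P)"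
      by (simp only: pochhammer_rec[of b "Suc m"] p2)
    have nz: "b \<noteq> 0" "b + 1 + of_nat m \<noteq> 0" "P \<noteq> 0"
      using p3 pochhammer_slit_plane_nonzero[OF a, of n "Suc (Suc m)"] by (auto simp: b_def)
    have b: "of_nat (Suc n) + a = b + 1" by (simp add: b_def)
    have "u m n - u m (Suc n) = fact m * (1 / (b * P) - 1 / ((b + 1 + of_nat m) * P))"
      unfolding u_def b p2 b_def[symmetric] p1 by (simp add: right_diff_distrib)
    also have "1 / (b * P) - 1 / ((b + 1 + of_nat m) * P) =
        (of_nat m + 1) / (b * ((b + 1 + of_nat m) * P))"
      using nz by (simp add: divide_simps)
    also have "fact m * \<dots> = u (Suc m) n"
      unfolding u_def b_def[symmetric] p3 by (simp add: algebra_simps)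
    finally show ?thesis .
  qed
  have "(\<lambda>n. z ^ Suc n * u m (Suc n)) sums (lerch_tail z m a - u m 0)"
    using sums_Suc_iff[of "\<lambda>n. z ^ n * u m n" "lerch_tail z m a - u m 0"] s[of m] by simp
  \<comment> \<open>\<open>z * lerch_tail z m a\<close> is evaluated a second time: by
    \<open>diff\<close>, each coefficient \<open>u m n\<close> splits into
    \<open>u m (Suc n) + u (Suc m) n\<close>.\<close>
  from sums_add[OF this sums_mult[OF s[of "Suc m"], of z]]
  have "(\<lambda>n. z ^ Suc n * (u m (Suc n) + u (Suc m) n)) sums
      (lerch_tail z m a - u m 0 + z * lerch_tail z (Suc m) a)"
    by (simp add: algebra_simps)
  also have "(\<lambda>n. z ^ Suc n * (u m (Suc n) + u (Suc m) n)) = (\<lambda>n. z * (z ^ n * u m n))"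
    unfolding diff[symmetric] by (simp add: ac_simps)
  finally have "lerch_tail z m a - u m 0 + z * lerch_tail z (Suc m) a = z * lerch_tail z m a"
    using sums_mult[OF s[of m], of z] sums_unique2 by blast
  then show ?thesis by (simp add: u_def algebra_simps)
qed

text \<open>The recurrence is solved for the tail by dividing by 1 - z and iterated M times. The
  identity is exact, so both the convergence of the factorial series and all remainder estimates
  reduce to bounds for the last summand.\<close>

lemma lerch_phi_expansion:
  assumes z: "norm z < 1" and a: "a \<in> slit_plane"
  shows "lerch_phi z 1 a =
    (\<Sum>m<M. (- z) ^ m * fact m / ((1 - z) ^ Suc m * pochhammer a (Suc m)))
    + (- z / (1 - z)) ^ M * lerch_tail z M a"
proof (induction M)
  case 0
  then show ?case by (simp add: lerch_phi_eq_tail)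
next
  case (Suc M)
  have z1: "1 - z \<noteq> 0" using z by auto
  have L: "lerch_tail z M a = (fact M / pochhammer a (Suc M) - z * lerch_tail z (Suc M) a) / (1 - z)"
    using lerch_tail_rec[OF z a, of M] z1 by (simp add: field_simps)
  have "(- z / (1 - z)) ^ M * ((X - z * L) / (1 - z)) =
     (- z) ^ M / (1 - z) ^ Suc M * X + (- z / (1 - z)) ^ Suc M * L" for X L
    using z1 unfolding power_divide by (simp add: diff_divide_distrib right_diff_distrib mult.commute)
  from this[of "fact M / pochhammer a (Suc M)" "lerch_tail z (Suc M) a"]
  have "(- z / (1 - z)) ^ M * lerch_tail z M a =
     (- z) ^ M * fact M / ((1 - z) ^ Suc M * pochhammer a (Suc M))
     + (- z / (1 - z)) ^ Suc M * lerch_tail z (Suc M) a"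
    unfolding L by simp
  with Suc show ?case by simp
qed

text \<open>Passing from b to b + 1 replaces the factor b by \<open>b + of_nat (Suc M)\<close>, and
  this does not decrease the modulus as soon as \<open>0 \<le> 2 * Re b + real (Suc M)\<close>. The
  hypothesis gives this for every b = n + a.\<close>

lemma norm_pochhammer_le_shift:
  assumes a: "a \<in> slit_plane" and M: "0 \<le> 2 * Re a + real (Suc M)"
  shows "norm (pochhammer a (Suc M)) \<le> norm (pochhammer (of_nat n + a) (Suc M))"
proof (induction n)
  case (Suc n)
  define b where "b = of_nat n + a"
  have b: "b \<noteq> 0"
    using slit_plane_add_of_nat_nonzero[OF a, of n] by (simp add: b_def ac_simps)
  have "norm b \<le> norm (b + of_nat (Suc M))"
  proof (rule power2_le_imp_le)
    have "0 \<le> (2 * Re b + real (Suc M)) * real (Suc M)"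
      using M by (intro mult_nonneg_nonneg) (auto simp: b_def)
    also have "\<dots> = (norm (b + of_nat (Suc M)))\<^sup>2 - (norm b)\<^sup>2"
      unfolding cmod_power2 by (simp add: power2_eq_square algebra_simps)
    finally show "(norm b)\<^sup>2 \<le> (norm (b + of_nat (Suc M)))\<^sup>2" by simp
  qed simp
  then have "norm b * norm (pochhammer b (Suc M)) \<le>
      norm (b + of_nat (Suc M)) * norm (pochhammer b (Suc M))"
    by (intro mult_right_mono) auto
  \<comment> \<open>Both sides are the modulus of \<open>pochhammer b (Suc (Suc M))\<close>, split
    off at its last or at its first factor.\<close>
  also have "\<dots> = norm b * norm (pochhammer (b + 1) (Suc M))"
    by (metis norm_mult pochhammer_rec pochhammer_rec')
  finally have "norm (pochhammer b (Suc M)) \<le> norm (pochhammer (b + 1) (Suc M))"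
    using b by simp
  with Suc show ?case by (simp add: b_def ac_simps)
qed simp

lemma lerch_tail_bigo:
  assumes z: "norm z < 1" and a: "a \<in> slit_plane"
  shows "(\<lambda>M. norm (lerch_tail z M a)) \<in> O(\<lambda>M. real M powr (- Re a))"
proof -
  have "\<forall>\<^sub>F M in sequentially. norm (norm (lerch_tail z M a)) \<le>
    1 / (1 - norm z) * norm (norm (Gamma_series a M) * real M powr (- Re a))"
    using eventually_ge_at_top[of "max 1 (nat \<lceil>- 2 * Re a\<rceil>)"]
  proof eventually_elim
    case (elim M)
    then have M: "0 \<le> 2 * Re a + real (Suc M)" "M > 0"
      by (auto simp: nat_le_iff ceiling_le_iff)
    have "norm (pochhammer a (Suc M)) > 0"
      using pochhammer_slit_plane_nonzero[OF a, of 0 "Suc M"] by simp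
    then have "norm (lerch_tail z M a) \<le> fact M / norm (pochhammer a (Suc M)) / (1 - norm z)"
      by (rule lerch_tail_bound(2)[OF z _ norm_pochhammer_le_shift[OF a M(1)]])
    \<comment> \<open>\<open>Gamma_series a M\<close> is
      \<open>fact M * exp (a * ln M) / pochhammer a (Suc M)\<close>, and the exponential has modulus
      \<open>M powr Re a\<close>. The series tends to \<open>Gamma a\<close>, hence is
      bounded.\<close>
    also have "fact M / norm (pochhammer a (Suc M)) = norm (Gamma_series a M) * real M powr (- Re a)"
      using M(2) by (simp add: Gamma_series_def norm_mult norm_divide powr_def exp_minus field_simps)
    finally show ?case by simp
  qed
  then have "(\<lambda>M. norm (lerch_tail z M a)) \<in>
      O(\<lambda>M. norm (Gamma_series a M) * real M powr (- Re a))"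
    by (rule bigoI)
  also have "(\<lambda>M. norm (Gamma_series a M) * real M powr (- Re a)) \<in>
      O(\<lambda>M. 1 * real M powr (- Re a))"
  proof (rule landau_o.big.mult)
    have "(\<lambda>M. norm (Gamma_series a M)) \<longlonglongrightarrow> norm (Gamma a)"
      by (intro tendsto_norm Gamma_series_LIMSEQ)
    then show "(\<lambda>M. norm (Gamma_series a M)) \<in> O(\<lambda>_. 1)"
      by (intro bigoI_tendsto[where c = "norm (Gamma a)"]) auto
  qed simp
  finally show ?thesis by simp
qed

section \<open>Laplace integrals as Lerch series\<close>

lemma has_integral_exp_minus_complex:
  fixes x :: complex
  assumes "Re x > 0"
  shows "((\<lambda>p. exp (- x * of_real p)) has_integral 1 / x) {0..}"
proof (rule has_integral_dominated_convergence)
  have x: "x \<noteq> 0" using assms by auto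
  define I where "I n = - exp (- x * of_real (real n)) / x - (- exp (- x * of_real 0) / x)" for n
  show "((\<lambda>p. if p \<in> {0..real n} then exp (- x * of_real p) else 0) has_integral I n) {0..}" for n
  proof -
    have "((\<lambda>p. exp (- x * of_real p)) has_integral I n) {0..real n}"
      unfolding I_def
    proof (rule fundamental_theorem_of_calculus)
      fix p :: real
      show "((\<lambda>p. - exp (- x * of_real p) / x) has_vector_derivative exp (- x * of_real p))
              (at p within {0..real n})"
        using x by (intro has_vector_derivative_real_field) (auto intro!: derivative_eq_intros)
    qed simp
    then show ?thesis by (subst has_integral_restrict) auto
  qed
  show "(\<lambda>p. exp (- Re x * p)) integrable_on {0..}"
    using has_integral_exp_minus_to_infinity[OF assms, of 0] by blast
  show "\<forall>p\<in>{0..}. norm (if p \<in> {0..real n} then exp (- x * of_real p) else 0) \<le> exp (- Re x * p)" for n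
    by (simp add: norm_exp_eq_Re)
  show "\<forall>p\<in>{0..}. (\<lambda>n. if p \<in> {0..real n} then exp (- x * of_real p) else 0) \<longlonglongrightarrow> exp (- x * of_real p)"
  proof
    fix p :: real assume "p \<in> {0..}"
    then show "(\<lambda>n. if p \<in> {0..real n} then exp (- x * of_real p) else 0) \<longlonglongrightarrow> exp (- x * of_real p)"
      using eventually_ge_at_top[of "nat \<lceil>p\<rceil>"]
      by (intro tendsto_eventually) (auto elim!: eventually_mono simp: nat_le_iff ceiling_le_iff)
  qed
  have "(\<lambda>n. exp (- Re x * real n)) \<longlonglongrightarrow> 0"
    using assms by real_asymp
  then have "(\<lambda>n. exp (- x * of_real (real n))) \<longlonglongrightarrow> 0"
    by (intro tendsto_norm_zero_cancel[of "\<lambda>n. exp (- x * of_real (real n))"])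
       (simp add: norm_exp_eq_Re)
  then have "I \<longlonglongrightarrow> - 0 / x - (- exp (- x * of_real 0) / x)"
    unfolding I_def by (intro tendsto_intros x)
  then show "I \<longlonglongrightarrow> 1 / x" by simp
qed

text \<open>The majorant is \<open>C * exp (- Re x * p)\<close>. It serves both for partial sums of
  geometric series and for the dyadic approximants of 1 / (p + 1).\<close>

lemma laplace_dominated_convergence:
  fixes x :: complex and g :: "nat \<Rightarrow> real \<Rightarrow> complex"
  assumes "Re x > 0"
    and "\<And>N. ((\<lambda>p. exp (- x * of_real p) * g N p) has_integral I N) {0..}"
    and "\<And>N p. p \<ge> 0 \<Longrightarrow> norm (g N p) \<le> C"
    and "\<And>p. p \<ge> 0 \<Longrightarrow> (\<lambda>N. g N p) \<longlonglongrightarrow> G p"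
    and "I \<longlonglongrightarrow> L"
  shows "((\<lambda>p. exp (- x * of_real p) * G p) has_integral L) {0..}"
proof (rule has_integral_dominated_convergence[OF assms(2)])
  show "(\<lambda>p. exp (- Re x * p) * C) integrable_on {0..}"
    using has_integral_exp_minus_to_infinity[OF assms(1), of 0] by (intro integrable_on_mult_left) blast
  show "\<forall>p\<in>{0..}. norm (exp (- x * of_real p) * g N p) \<le> exp (- Re x * p) * C" for N
    using assms(3) by (auto simp: norm_mult norm_exp_eq_Re intro!: mult_left_mono)
  show "\<forall>p\<in>{0..}. (\<lambda>N. exp (- x * of_real p) * g N p) \<longlonglongrightarrow> exp (- x * of_real p) * G p"
    using assms(4) by (auto intro!: tendsto_intros)
qed fact

text \<open>Expand the kernel in powers of \<open>z * exp (- s * p)\<close> and integrate termwise.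
  The step s is 1 for the integrals J and K in their own variables, and \<open>1 / 2 ^ k\<close> for
  the pieces written in the variable p of f.\<close>

lemma laplace_geometric:
  fixes x z :: complex and s :: real
  assumes x: "Re x > 0" and z: "norm z < 1" and s: "s \<ge> 0"
  shows "((\<lambda>p. exp (- x * of_real p) * (1 / (1 - z * exp (- of_real (s * p)))))
           has_integral (\<Sum>n. z ^ n / (x + of_real (s * real n)))) {0..}"
proof (rule laplace_dominated_convergence[OF x])
  have w: "norm (z * exp (- of_real (s * p))) \<le> norm z" if "p \<ge> 0" for p
    using s that by (simp add: norm_mult norm_exp_eq_Re mult_left_le)
  show "((\<lambda>p. exp (- x * of_real p) * (\<Sum>n<N. (z * exp (- of_real (s * p))) ^ n))
      has_integral (\<Sum>n<N. z ^ n / (x + of_real (s * real n)))) {0..}" for N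
  proof -
    have "((\<lambda>p. z ^ n * exp (- (x + of_real (s * real n)) * of_real p))
        has_integral z ^ n * (1 / (x + of_real (s * real n)))) {0..}" for n
      using x s by (intro has_integral_mult_right has_integral_exp_minus_complex) (auto intro: add_pos_nonneg)
    then have "((\<lambda>p. \<Sum>n<N. z ^ n * exp (- (x + of_real (s * real n)) * of_real p))
        has_integral (\<Sum>n<N. z ^ n * (1 / (x + of_real (s * real n))))) {0..}"
      by (intro has_integral_sum) auto
    moreover have "z ^ n * exp (- (x + of_real (s * real n)) * of_real p) =
        exp (- x * of_real p) * (z * exp (- of_real (s * p))) ^ n" for n p
      by (simp add: power_mult_distrib algebra_simps flip: exp_of_nat_mult exp_add)
    ultimately show ?thesis by (simp add: sum_distrib_left)
  qed
  show "norm (\<Sum>n<N. (z * exp (- of_real (s * p))) ^ n) \<le> 1 / (1 - norm z)" if "p \<ge> 0" for N p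
  proof -
    have "norm (\<Sum>n<N. (z * exp (- of_real (s * p))) ^ n) \<le> (\<Sum>n<N. norm z ^ n)"
      by (rule sum_norm_le) (unfold norm_power, intro power_mono w that norm_ge_zero)
    also have "\<dots> \<le> (\<Sum>n. norm z ^ n)"
      using z by (intro sum_le_suminf summable_geometric) auto
    also have "\<dots> = 1 / (1 - norm z)"
      using z by (intro suminf_geometric) auto
    finally show ?thesis .
  qed
  show "(\<lambda>N. \<Sum>n<N. (z * exp (- of_real (s * p))) ^ n) \<longlonglongrightarrow> 1 / (1 - z * exp (- of_real (s * p)))"
    if "p \<ge> 0" for p
    using geometric_sums[of "z * exp (- of_real (s * p))"] w[OF that] z by (simp add: sums_def)
  have "summable (\<lambda>n. z ^ n / (x + of_real (s * real n)))"
  proof (rule summable_comparison_test')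
    show "summable (\<lambda>n. norm z ^ n / Re x)"
      using z by (intro summable_divide summable_geometric) auto
    fix n
    have "Re x \<le> Re (x + of_real (s * real n))" using s by simp
    also have "\<dots> \<le> norm (x + of_real (s * real n))" by (rule complex_Re_le_cmod)
    finally show "norm (z ^ n / (x + of_real (s * real n))) \<le> norm z ^ n / Re x"
      using x unfolding norm_divide norm_power by (intro frac_le) auto
  qed
  then show "(\<lambda>N. \<Sum>n<N. z ^ n / (x + of_real (s * real n))) \<longlonglongrightarrow> (\<Sum>n. z ^ n / (x + of_real (s * real n)))"
    by (rule summable_LIMSEQ)
qed

section \<open>Holomorphic continuation by Lerch series\<close>

lemma lerch_phi_one: "lerch_phi z 1 a = (\<Sum>n. z ^ n / (a + of_nat n))"
  by (simp add: lerch_phi_eq_tail lerch_tail_def add.commute)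

text \<open>The Weierstrass M-test on small discs, since the majorants degenerate towards the cut.
  It is applied to the Lerch series and then to the sum over k.\<close>

lemma holomorphic_on_suminf:
  fixes f :: "nat \<Rightarrow> complex \<Rightarrow> complex"
  assumes "open S" "\<And>n. f n holomorphic_on S"
    and "\<And>x. x \<in> S \<Longrightarrow> \<exists>d M. d > 0 \<and> cball x d \<subseteq> S \<and> summable M \<and>
          (\<forall>n. \<forall>y\<in>cball x d. norm (f n y) \<le> M n)"
  shows "(\<lambda>x. \<Sum>n. f n x) holomorphic_on S"
proof (rule holomorphic_uniform_sequence[OF assms(1)])
  show "(\<lambda>x. \<Sum>n<N. f n x) holomorphic_on S" for N
    using assms(2) by (intro holomorphic_intros)
  fix x assume "x \<in> S"
  from assms(3)[OF this] obtain d M where "d > 0" "cball x d \<subseteq> S" "summable M"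
    "\<forall>n. \<forall>y\<in>cball x d. norm (f n y) \<le> M n" by blast
  then show "\<exists>d>0. cball x d \<subseteq> S \<and>
      uniform_limit (cball x d) (\<lambda>N x. \<Sum>n<N. f n x) (\<lambda>x. \<Sum>n. f n x) sequentially"
    by (intro exI[of _ d] conjI Weierstrass_m_test) auto
qed

lemma lerch_phi_holomorphic:
  assumes z: "norm z < 1"
  shows "lerch_phi z 1 holomorphic_on slit_plane"
proof -
  have "(\<lambda>a. \<Sum>n. z ^ n / (a + of_nat n)) holomorphic_on slit_plane"
  proof (rule holomorphic_on_suminf[OF open_slit_plane])
    show "(\<lambda>a. z ^ n / (a + of_nat n)) holomorphic_on slit_plane" for n
      by (intro holomorphic_intros slit_plane_add_of_nat_nonzero)
    fix x assume "x \<in> slit_plane"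
    then obtain c d where c: "c > 0" "d > 0" "cball x d \<subseteq> slit_plane"
      "\<And>y t. y \<in> cball x d \<Longrightarrow> t \<ge> 0 \<Longrightarrow> c * (1 + t) \<le> norm (y + of_real t)"
      using slit_plane_local_bound by blast
    have "norm (z ^ n / (y + of_nat n)) \<le> norm z ^ n / c" if "y \<in> cball x d" for n y
    proof -
      have "c * 1 \<le> c * (1 + real n)" using c(1) by (intro mult_left_mono) auto
      also have "\<dots> \<le> norm (y + of_nat n)" using c(4)[OF that, of "real n"] by simp
      finally show ?thesis
        using c(1) unfolding norm_divide norm_power by (intro frac_le) auto
    qed
    moreover have "summable (\<lambda>n. norm z ^ n / c)"
      using z by (intro summable_divide summable_geometric) auto
    ultimately show "\<exists>d M. d > 0 \<and> cball x d \<subseteq> slit_plane \<and> summable M \<and>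
        (\<forall>n. \<forall>y\<in>cball x d. norm (z ^ n / (y + of_nat n)) \<le> M n)"
      using c by blast
  qed
  then show ?thesis by (simp add: lerch_phi_one[abs_def])
qed

text \<open>Exhibiting one continuation F suffices: existence gives the choice operator its
  property, and uniqueness on the slit plane identifies its values with those of F.\<close>

lemma continued_integral:
  assumes "continues_integral g F"
  shows "continues_integral g (continued_integral g)"
    and "x \<in> slit_plane \<Longrightarrow> continued_integral g x = F x"
proof -
  show *: "continues_integral g (continued_integral g)"
    unfolding continued_integral_def by (rule someI[of "continues_integral g", OF assms])
  show "continued_integral g x = F x" if "x \<in> slit_plane"
    using continues_integral_unique[OF * assms that] .
qed

lemma continues_J: "continues_integral J_integrand (lerch_phi (exp (- 1)) 1)"
  unfolding continues_integral_def
proof (intro conjI allI impI)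
  show "lerch_phi (exp (- 1)) 1 holomorphic_on slit_plane"
    by (rule lerch_phi_holomorphic) (simp add: norm_exp_eq_Re)
  fix x :: complex assume x: "Re x > 0"
  have "J_integrand x = (\<lambda>p. exp (- x * of_real p) * (1 / (1 - exp (- 1) * exp (- of_real (1 * p)))))"
    by (simp add: J_integrand_def exp_minus field_simps fun_eq_iff)
  then show "(J_integrand x has_integral lerch_phi (exp (- 1)) 1 x) {0..}"
    using laplace_geometric[OF x, of "exp (- 1)" 1]
    by (simp add: norm_exp_eq_Re lerch_phi_one)
qed

text \<open>Dividing numerator and denominator of \<open>K_integrand\<close> by
  \<open>exp (1 / 2 ^ k)\<close> turns its kernel into \<open>1 / (1 - z * exp (- q))\<close> with
  this z.\<close>

abbreviation (input) K_base :: "nat \<Rightarrow> complex" where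
  "K_base k \<equiv> - exp (- (1 / 2 ^ k))"

lemma K_base_eq: "K_base k = - of_real (exp (- (1 / 2 ^ k)))"
  by (simp flip: exp_of_real)

lemma norm_K_base: "norm (K_base k) < 1"
  unfolding K_base_eq by simp

lemma continues_K: "continues_integral (K_integrand k) (\<lambda>x. lerch_phi (K_base k) 1 (2 ^ k * x))"
  unfolding continues_integral_def
proof (intro conjI allI impI)
  have "(lerch_phi (K_base k) 1 \<circ> (\<lambda>x. 2 ^ k * x)) holomorphic_on slit_plane"
    by (rule holomorphic_on_compose_gen[OF _ lerch_phi_holomorphic[OF norm_K_base]])
       (auto intro!: holomorphic_intros slit_plane_scale)
  then show "(\<lambda>x. lerch_phi (K_base k) 1 (2 ^ k * x)) holomorphic_on slit_plane"
    by (simp add: o_def)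
  fix x :: complex assume x: "Re x > 0"
  have "K_integrand k x =
      (\<lambda>p. exp (- (2 ^ k * x) * of_real p) * (1 / (1 - K_base k * exp (- of_real (1 * p)))))"
    by (simp add: K_integrand_def exp_minus[of "1 / 2 ^ k"] divide_simps fun_eq_iff)
  then show "(K_integrand k x has_integral lerch_phi (K_base k) 1 (2 ^ k * x)) {0..}"
    using laplace_geometric[of "2 ^ k * x" "K_base k" 1] x norm_K_base[of k]
    by (simp add: lerch_phi_one)
qed

section \<open>The dyadic decomposition\<close>

text \<open>The terms of the Lerch series only give a bound O(1); one summation by parts gains the
  factor that makes the sum over \<open>k\<close> converge.\<close>
lemma lerch_phi_K_base_bound:
  assumes x: "x \<in> slit_plane"
  obtains d C where "d > 0" "cball x d \<subseteq> slit_plane"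
    "\<And>y k. y \<in> cball x d \<Longrightarrow> norm (lerch_phi (K_base k) 1 (2 ^ k * y)) \<le> C * (1 / 2 ^ k)"
proof -
  obtain c d where c: "c > 0" "d > 0" "cball x d \<subseteq> slit_plane"
    "\<And>y t. y \<in> cball x d \<Longrightarrow> t \<ge> 0 \<Longrightarrow> c * (1 + t) \<le> norm (y + of_real t)"
    using slit_plane_local_bound[OF x] by blast
  have "norm (lerch_phi (K_base k) 1 (2 ^ k * y)) \<le> (1 / c + 1 / c\<^sup>2) * (1 / 2 ^ k)"
    if y: "y \<in> cball x d" for y k
  proof -
    define a where "a = 2 ^ k * y"
    define N :: real where "N = 2 ^ k"
    define z where "z = K_base k"
    have N: "N > 0" by (simp add: N_def)
    have z: "norm z < 1" unfolding z_def by (rule norm_K_base)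
    have aS: "a \<in> slit_plane" unfolding a_def using c(3) y by (intro slit_plane_scale) auto
    \<comment> \<open>Scaling by N = 2 ^ k moves the origin of t: this gains the factor N already at
      t = 0.\<close>
    have a: "c * (N + t) \<le> norm (a + of_real t)" if "t \<ge> 0" for t
    proof -
      have "c * (N + t) = N * (c * (1 + t / N))" using N by (simp add: field_simps)
      also have "\<dots> \<le> N * norm (y + of_real (t / N))"
        using N that by (intro mult_left_mono c(4) y) auto
      also have "\<dots> = norm (of_real N * (y + of_real (t / N)))"
        using N by (simp add: norm_mult)
      also have "of_real N * (y + of_real (t / N)) = a + of_real t"
        using N by (simp add: distrib_left a_def) (simp add: N_def)
      finally show ?thesis .
    qed
    \<comment> \<open>Powers of z are bounded by 1 only, because \<open>norm z\<close> tends to 1 as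
      k grows. Convergence comes from the two factors of the denominator, whose lower bounds
      telescope.\<close>
    have "norm (z ^ n * fact 1 / pochhammer (of_nat n + a) (Suc 1)) \<le>
        1 / c\<^sup>2 * (1 / (N + real n) - 1 / (N + real (Suc n)))" for n
    proof -
      have "norm (z ^ n * fact 1 / pochhammer (of_nat n + a) (Suc 1)) =
          norm z ^ n / (norm (a + of_real (real n)) * norm (a + of_real (real (Suc n))))"
        by (simp add: pochhammer_Suc norm_divide norm_mult norm_power ac_simps numeral_2_eq_2)
      also have "\<dots> \<le> 1 / ((c * (N + real n)) * (c * (N + real (Suc n))))"
        using z c(1) N by (intro frac_le mult_mono a power_le_one mult_pos_pos) auto
      also have "\<dots> = 1 / c\<^sup>2 * (1 / (N + real n) - 1 / (N + real (Suc n)))"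
      proof -
        have "1 / u - 1 / (u + 1) = 1 / (u * (u + 1))" if "u > 0" for u :: real
          using that by (simp add: field_simps)
        from this[of "N + real n"] N show ?thesis
          by (simp add: power2_eq_square ac_simps)
      qed
      finally show ?thesis .
    qed
    moreover have "(\<lambda>n. 1 / c\<^sup>2 * (1 / (N + real n) - 1 / (N + real (Suc n)))) sums
        (1 / c\<^sup>2 * (1 / (N + real 0) - 0))"
      by (intro sums_mult telescope_sums'[where f = "\<lambda>n. 1 / (N + real n)"]) real_asymp
    ultimately have "norm (lerch_tail z 1 a) \<le> 1 / c\<^sup>2 * (1 / N)"
      unfolding lerch_tail_def by (metis (no_types, lifting) norm_suminf_le add.right_neutral
          diff_zero of_nat_0 sums_iff)
    moreover have "norm (1 / a) \<le> 1 / (c * N)"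
      using a[of 0] c(1) N by (simp add: norm_divide frac_le)
    moreover have "(1 - z) * lerch_phi z 1 a = 1 / a - z * lerch_tail z 1 a"
      using lerch_tail_rec[OF z aS, of 0] by (simp add: lerch_phi_eq_tail)
    then have "norm (1 - z) * norm (lerch_phi z 1 a) \<le> norm (1 / a) + norm z * norm (lerch_tail z 1 a)"
      by (metis norm_mult norm_triangle_ineq4)
    moreover have "norm z * norm (lerch_tail z 1 a) \<le> 1 * norm (lerch_tail z 1 a)"
      using z by (intro mult_right_mono) auto
    \<comment> \<open>z is negative real, so division by 1 - z loses nothing, uniformly in
      k.\<close>
    moreover have "1 * norm (lerch_phi z 1 a) \<le> norm (1 - z) * norm (lerch_phi z 1 a)"
    proof (intro mult_right_mono)
      have "1 - z = of_real (1 + exp (- (1 / 2 ^ k)))"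
        by (simp add: z_def K_base_eq)
      then show "1 \<le> norm (1 - z)" by (simp only: norm_of_real) simp
    qed simp
    ultimately have "norm (lerch_phi z 1 a) \<le> 1 / (c * N) + 1 / c\<^sup>2 * (1 / N)"
      by linarith
    then show ?thesis by (simp add: z_def a_def N_def add_divide_distrib)
  qed
  with c(2,3) show ?thesis by (intro that[of d "1 / c + 1 / c\<^sup>2"]) auto
qed

lemma summable_half_powers: "summable (\<lambda>k. C * (1 / 2 ^ Suc k) :: real)"
proof -
  have "summable (\<lambda>k. C / 2 * (1 / 2) ^ k :: real)"
    by (intro summable_mult summable_geometric) auto
  then show ?thesis by (simp add: power_one_over)
qed

lemma summable_K:
  assumes "x \<in> slit_plane"
  shows "summable (\<lambda>k. lerch_phi (K_base (Suc k)) 1 (2 ^ Suc k * x))"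
proof -
  obtain d C where d: "d > 0" "cball x d \<subseteq> slit_plane"
    and C: "\<And>y k. y \<in> cball x d \<Longrightarrow> norm (lerch_phi (K_base k) 1 (2 ^ k * y)) \<le> C * (1 / 2 ^ k)"
    using lerch_phi_K_base_bound[OF assms] by blast
  have "x \<in> cball x d" using d by simp
  from summable_comparison_test'[OF summable_half_powers C[OF this]] show ?thesis .
qed

text \<open>For y > 0 this is the left Riemann sum, with step \<open>1 / 2 ^ N\<close>, of the
  integral of exp (- y t) over t \<ge> 0, whose value is 1 / y.\<close>

definition dyadic :: "nat \<Rightarrow> real \<Rightarrow> real" where
  "dyadic N y = (1 / 2 ^ N) * (1 / (1 - exp (- (y / 2 ^ N))))"

lemma dyadic_Suc:
  assumes "y > 0"
  shows "dyadic (Suc N) y = dyadic N y - (1 / 2 ^ Suc N) * (1 / (1 + exp (- (y / 2 ^ Suc N))))"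
proof -
  define u where "u = exp (- (y / 2 ^ Suc N))"
  have u: "0 < u" "u < 1" using assms by (auto simp: u_def)
  have u2: "exp (- (y / 2 ^ N)) = u * u"
    unfolding u_def by (simp flip: exp_add)
  have "1 / (1 - u) = 2 / (1 - u * u) - 1 / (1 + u)"
  proof -
    have "1 - u * u = (1 - u) * (1 + u)" by (simp add: algebra_simps)
    moreover have "1 / (1 - u) = 2 / ((1 - u) * (1 + u)) - 1 / (1 + u)"
      using u by (simp add: divide_simps) (simp add: algebra_simps)
    ultimately show ?thesis by simp
  qed
  then show ?thesis
    unfolding dyadic_def u2 u_def[symmetric] by (simp add: right_diff_distrib)
qed

text \<open>With u = y / 2 ^ N, the inequalities u / (1 + u) \<le> 1 - exp (- u) \<le> u are
  inverted and multiplied by \<open>1 / 2 ^ N\<close>. They yield both the limit 1 / y and a bound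
  uniform in N for y \<ge> 1.\<close>

lemma dyadic_bounds:
  assumes "y > 0"
  shows "1 / y \<le> dyadic N y" "dyadic N y \<le> 1 / y + 1 / 2 ^ N"
proof -
  define u where "u = y / 2 ^ N"
  have u: "u > 0" using assms by (simp add: u_def)
  have 1: "1 - exp (- u) \<le> u" using exp_ge_add_one_self[of "- u"] by simp
  have 2: "1 - exp (- u) > 0" using u by simp
  have "exp (- u) \<le> 1 / (1 + u)"
    using exp_ge_add_one_self[of u] u by (simp add: exp_minus field_simps)
  then have 3: "u / (1 + u) \<le> 1 - exp (- u)" using u by (simp add: field_simps)
  have "1 / u \<le> 1 / (1 - exp (- u))" using 1 2 by (intro divide_left_mono) auto
  moreover have "1 / (1 - exp (- u)) \<le> 1 / (u / (1 + u))"
    using 3 2 u by (intro divide_left_mono) auto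
  moreover have "1 / (u / (1 + u)) = 1 / u + 1" using u by (simp add: field_simps)
  ultimately have *: "1 / u \<le> 1 / (1 - exp (- u))" "1 / (1 - exp (- u)) \<le> 1 / u + 1" by auto
  have "1 / 2 ^ N * (1 / u) = 1 / y" by (simp add: u_def)
  then show "1 / y \<le> dyadic N y" "dyadic N y \<le> 1 / y + 1 / 2 ^ N"
    using mult_left_mono[OF *(1), of "1 / 2 ^ N"] mult_left_mono[OF *(2), of "1 / 2 ^ N"]
    unfolding dyadic_def u_def[symmetric] by (simp_all only: distrib_left) auto
qed

lemma dyadic_tendsto:
  assumes "y > 0"
  shows "(\<lambda>N. dyadic N y) \<longlonglongrightarrow> 1 / y"
proof (rule tendsto_sandwich[OF _ _ tendsto_const])
  have "(\<lambda>N. 1 / y + (1 / 2) ^ N) \<longlonglongrightarrow> 1 / y + 0"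
    by (intro tendsto_intros) auto
  then show "(\<lambda>N. 1 / y + 1 / 2 ^ N) \<longlonglongrightarrow> 1 / y" by (simp add: power_one_over)
qed (use dyadic_bounds[OF assms] in auto)

text \<open>This is the k-th integral after q = p / 2 ^ k. Instead of a change of variables, the
  geometric expansion is used with step \<open>1 / 2 ^ k\<close>, and the factor in front is
  absorbed into the denominators.\<close>

lemma has_integral_K_piece:
  assumes x: "Re x > 0"
  shows "((\<lambda>p. exp (- x * of_real p) * of_real ((1 / 2 ^ k) * (1 / (1 + exp (- ((p + 1) / 2 ^ k))))))
           has_integral lerch_phi (K_base k) 1 (2 ^ k * x)) {0..}"
proof -
  have "1 / 2 ^ k * (K_base k ^ n / (x + of_real (1 / 2 ^ k * real n))) = K_base k ^ n / (2 ^ k * x + of_nat n)" for n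
    by (simp add: distrib_left)
  moreover have "summable (\<lambda>n. K_base k ^ n / (x + of_real (1 / 2 ^ k * real n)))"
  proof -
    have "summable (\<lambda>n. 2 ^ k * (K_base k ^ n * fact 0 / pochhammer (of_nat n + 2 ^ k * x) (Suc 0)))"
      using x by (intro summable_mult summable_lerch_tail norm_K_base slit_plane_scale slit_plane_Re_pos)
    also have "(\<lambda>n. 2 ^ k * (K_base k ^ n * fact 0 / pochhammer (of_nat n + 2 ^ k * x) (Suc 0)))
        = (\<lambda>n. K_base k ^ n / (x + of_real (1 / 2 ^ k * real n)))"
    proof
      fix n
      have "of_nat n + 2 ^ k * x = 2 ^ k * (x + of_real (1 / 2 ^ k * real n))"
        by (simp add: distrib_left)
      then show "2 ^ k * (K_base k ^ n * fact 0 / pochhammer (of_nat n + 2 ^ k * x) (Suc 0))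
        = K_base k ^ n / (x + of_real (1 / 2 ^ k * real n))" by simp
    qed
    finally show ?thesis .
  qed
  ultimately have S: "1 / 2 ^ k * (\<Sum>n. K_base k ^ n / (x + of_real (1 / 2 ^ k * real n)))
      = lerch_phi (K_base k) 1 (2 ^ k * x)"
    unfolding lerch_phi_one by (subst suminf_mult[symmetric]) auto
  have "((\<lambda>p. 1 / 2 ^ k * (exp (- x * of_real p) * (1 / (1 - K_base k * exp (- of_real (1 / 2 ^ k * p))))))
      has_integral lerch_phi (K_base k) 1 (2 ^ k * x)) {0..}"
    unfolding S[symmetric]
    by (intro has_integral_mult_right laplace_geometric x norm_K_base) simp
  also have "(\<lambda>p. 1 / 2 ^ k * (exp (- x * of_real p) * (1 / (1 - K_base k * exp (- of_real (1 / 2 ^ k * p))))))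
     = (\<lambda>p. exp (- x * of_real p) * of_real ((1 / 2 ^ k) * (1 / (1 + exp (- ((p + 1) / 2 ^ k))))))"
  proof
    fix p :: real
    \<comment> \<open>The base supplies the shift from p to p + 1.\<close>
    have "K_base k * exp (- of_real (1 / 2 ^ k * p)) = - of_real (exp (- ((p + 1) / 2 ^ k)))"
    proof -
      have "- (1 / 2 ^ k) + - of_real (1 / 2 ^ k * p) = (of_real (- ((p + 1) / 2 ^ k)) :: complex)"
        by (simp add: add_divide_distrib)
      then have "exp (- (1 / 2 ^ k)) * exp (- of_real (1 / 2 ^ k * p)) =
          (of_real (exp (- ((p + 1) / 2 ^ k))) :: complex)"
        by (metis exp_add exp_of_real)
      then show ?thesis by simp
    qed
    then show "1 / 2 ^ k * (exp (- x * of_real p) * (1 / (1 - K_base k * exp (- of_real (1 / 2 ^ k * p))))) =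
        exp (- x * of_real p) * of_real ((1 / 2 ^ k) * (1 / (1 + exp (- ((p + 1) / 2 ^ k)))))"
      by simp
  qed
  finally show ?thesis .
qed

lemma continues_f:
  "continues_integral f_integrand (\<lambda>x. lerch_phi (exp (- 1)) 1 x
      - (\<Sum>k. lerch_phi (K_base (Suc k)) 1 (2 ^ Suc k * x)))"
  unfolding continues_integral_def
proof (intro conjI allI impI)
  have "(\<lambda>x. \<Sum>k. lerch_phi (K_base (Suc k)) 1 (2 ^ Suc k * x)) holomorphic_on slit_plane"
  proof (rule holomorphic_on_suminf[OF open_slit_plane])
    show "(\<lambda>x. lerch_phi (K_base (Suc k)) 1 (2 ^ Suc k * x)) holomorphic_on slit_plane" for k
      using continues_K[of "Suc k"] unfolding continues_integral_def by blast
    fix x assume "x \<in> slit_plane"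
    then obtain d C where "d > 0" "cball x d \<subseteq> slit_plane"
      "\<And>y k. y \<in> cball x d \<Longrightarrow> norm (lerch_phi (K_base k) 1 (2 ^ k * y)) \<le> C * (1 / 2 ^ k)"
      using lerch_phi_K_base_bound by blast
    then show "\<exists>d M. d > 0 \<and> cball x d \<subseteq> slit_plane \<and> summable M \<and>
        (\<forall>n. \<forall>y\<in>cball x d. norm (lerch_phi (K_base (Suc n)) 1 (2 ^ Suc n * y)) \<le> M n)"
      using summable_half_powers[of C] by blast
  qed
  then show "(\<lambda>x. lerch_phi (exp (- 1)) 1 x - (\<Sum>k. lerch_phi (K_base (Suc k)) 1 (2 ^ Suc k * x)))
      holomorphic_on slit_plane"
    using continues_J unfolding continues_integral_def by (intro holomorphic_intros) auto
  fix x :: complex assume x: "Re x > 0"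
  define I where "I N = lerch_phi (exp (- 1)) 1 x
    - (\<Sum>k<N. lerch_phi (K_base (Suc k)) 1 (2 ^ Suc k * x))" for N
  have "((\<lambda>p. exp (- x * of_real p) * (1 / of_real (p + 1))) has_integral
      (lerch_phi (exp (- 1)) 1 x - (\<Sum>k. lerch_phi (K_base (Suc k)) 1 (2 ^ Suc k * x)))) {0..}"
  proof (rule laplace_dominated_convergence[OF x])
    \<comment> \<open>Each refinement by \<open>dyadic_Suc\<close> subtracts one K piece, so the
      approximants integrate exactly to the partial sums over k.\<close>
    show "((\<lambda>p. exp (- x * of_real p) * of_real (dyadic N (p + 1))) has_integral I N) {0..}" for N
    proof (induction N)
      case 0
      have "((\<lambda>p. exp (- x * of_real p) * (1 / (1 - exp (- 1) * exp (- of_real (1 * p))))) has_integral I 0) {0..}"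
        using laplace_geometric[OF x, of "exp (- 1)" 1]
        by (simp add: norm_exp_eq_Re lerch_phi_one I_def)
      moreover have "exp (- 1) * exp (- of_real (1 * p)) = (of_real (exp (- (p + 1))) :: complex)" for p
        by (simp add: add.commute flip: exp_add exp_of_real)
      ultimately show ?case by (simp add: dyadic_def)
    next
      case (Suc N)
      have "((\<lambda>p. exp (- x * of_real p) * of_real (dyadic N (p + 1)) -
          exp (- x * of_real p) * of_real ((1 / 2 ^ Suc N) * (1 / (1 + exp (- ((p + 1) / 2 ^ Suc N))))))
          has_integral I N - lerch_phi (K_base (Suc N)) 1 (2 ^ Suc N * x)) {0..}"
        by (intro has_integral_diff Suc has_integral_K_piece x)
      also have "I N - lerch_phi (K_base (Suc N)) 1 (2 ^ Suc N * x) = I (Suc N)"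
        by (simp add: I_def)
      finally show ?case
        by (rule has_integral_eq[rotated])
           (subst dyadic_Suc; simp only: of_real_diff right_diff_distrib atLeast_iff; simp)
    qed
    show "norm (of_real (dyadic N (p + 1)) :: complex) \<le> 2" if "p \<ge> 0" for N p
    proof -
      have "1 / (p + 1) \<le> 1" "1 / 2 ^ N \<le> (1 :: real)" "0 \<le> 1 / (p + 1)" using that by auto
      then show ?thesis
        using dyadic_bounds[of "p + 1" N] that unfolding norm_of_real by linarith
    qed
    show "(\<lambda>N. of_real (dyadic N (p + 1)) :: complex) \<longlonglongrightarrow> 1 / of_real (p + 1)" if "p \<ge> 0" for p
      using tendsto_of_real[OF dyadic_tendsto[of "p + 1"], where 'a = complex] that by simp
    show "I \<longlonglongrightarrow> lerch_phi (exp (- 1)) 1 x - (\<Sum>k. lerch_phi (K_base (Suc k)) 1 (2 ^ Suc k * x))"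
      unfolding I_def
      by (intro tendsto_intros summable_LIMSEQ summable_K slit_plane_Re_pos x)
  qed
  then show "(f_integrand x has_integral
      (lerch_phi (exp (- 1)) 1 x - (\<Sum>k. lerch_phi (K_base (Suc k)) 1 (2 ^ Suc k * x)))) {0..}"
    by (simp add: f_integrand_def[abs_def])
qed

section \<open>Factorial series and remainders\<close>

text \<open>Rewrites the Euler coefficients in w = 1 / z, with w = e for J and w = - exp (1 / 2 ^ k)
  for K.\<close>

lemma power_inverse_ratio:
  fixes w :: complex
  assumes "w \<noteq> 0"
  shows "(- (1 / w)) ^ m / (1 - 1 / w) ^ Suc m = (- 1) ^ m * w / (w - 1) ^ Suc m"
proof -
  have "1 - 1 / w = (w - 1) / w" using assms by (simp add: field_simps)
  then show ?thesis
    using assms by (simp add: power_divide power_minus[of "1 / w"] power_one_over)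
qed

text \<open>The index starts at 0, so this is the term of index m + 1 in the factorial
  series.\<close>

definition euler_term :: "complex \<Rightarrow> nat \<Rightarrow> complex \<Rightarrow> complex" where
  "euler_term z m a = (- z) ^ m * fact m / ((1 - z) ^ Suc m * pochhammer a (Suc m))"

lemma J_term_Suc: "J_term (Suc m) x = euler_term (exp (- 1)) m x"
proof -
  have "euler_term (exp (- 1)) m x =
      (- (1 / exp 1)) ^ m / (1 - 1 / exp 1) ^ Suc m * (fact m / pochhammer x (Suc m))"
    by (simp add: euler_term_def exp_minus inverse_eq_divide)
  also have "\<dots> = J_term (Suc m) x"
    unfolding power_inverse_ratio[OF exp_not_eq_zero]
    using Gamma_fact[of m, where 'a = complex] by (simp add: J_term_def add.commute)
  finally show ?thesis ..
qed

lemma K_term_Suc: "K_term k (Suc m) x = euler_term (K_base k) m (2 ^ k * x)"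
proof -
  define E :: complex where "E = exp (1 / 2 ^ k)"
  have E: "- E \<noteq> 0" by (simp add: E_def)
  \<comment> \<open>The m + 1 minus signs of the numerator cancel those of the denominator, so the
    series for K does not alternate.\<close>
  have sign: "(- 1) ^ m * (- E) / (- E - 1) ^ Suc m = E / (E + 1) ^ Suc m"
  proof -
    have "- E - 1 = - (E + 1)" by simp
    then show ?thesis
      unfolding \<open>- E - 1 = - (E + 1)\<close> power_minus[of "E + 1"] by simp
  qed
  have "K_base k = 1 / (- E)"
    by (simp add: E_def exp_minus inverse_eq_divide)
  then have "euler_term (K_base k) m (2 ^ k * x) =
      (- (1 / (- E))) ^ m / (1 - 1 / (- E)) ^ Suc m * (fact m / pochhammer (2 ^ k * x) (Suc m))"
    by (simp add: euler_term_def)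
  also have "\<dots> = K_term k (Suc m) x"
    unfolding power_inverse_ratio[OF E] sign
    using Gamma_fact[of m, where 'a = complex] by (simp add: K_term_def E_def add.commute)
  finally show ?thesis ..
qed

text \<open>Truncated subtraction makes both sums empty for n = 0 as well as for n = 1.\<close>

lemma sum_shift_pred: "(\<Sum>m=1..<n. g m) = (\<Sum>m<n - 1. g (Suc m))"
  by (cases n) (simp_all only: One_nat_def sum.atLeast_Suc_lessThan_Suc_shift, simp_all add: atLeast0LessThan)

section \<open>Exact remainders and convergence of the factorial series\<close>

lemma J_int_eq: "x \<in> slit_plane \<Longrightarrow> J_int x = lerch_phi (exp (- 1)) 1 x"
  unfolding J_int_def by (rule continued_integral(2)[OF continues_J])

lemma K_int_eq: "x \<in> slit_plane \<Longrightarrow> K_int k x = lerch_phi (K_base k) 1 (2 ^ k * x)"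
  unfolding K_int_def by (rule continued_integral(2)[OF continues_K])

lemma norm_ratio_J: "norm (- exp (- 1) / (1 - exp (- 1)) :: complex) = 1 / (exp 1 - 1)"
proof -
  have "- exp (- 1) / (1 - exp (- 1)) = (of_real (- 1 / (exp 1 - 1)) :: complex)"
    by (simp add: exp_minus field_simps flip: exp_of_real)
  then show ?thesis by (simp only: norm_of_real) simp
qed

lemma norm_ratio_K: "norm (- K_base k / (1 - K_base k)) = 1 / (1 + exp (1 / 2 ^ k))"
proof -
  have e: "exp (1 / 2 ^ k) > (0 :: real)" by simp
  have "- K_base k / (1 - K_base k) = of_real (exp (- (1 / 2 ^ k)) / (1 + exp (- (1 / 2 ^ k))))"
    unfolding K_base_eq by simp
  also have "exp (- (1 / 2 ^ k)) / (1 + exp (- (1 / 2 ^ k))) = 1 / (1 + exp (1 / 2 ^ k) :: real)"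
    using e by (simp add: exp_minus divide_simps)
  finally show ?thesis using e by (simp only: norm_of_real) simp
qed

lemma norm_exp_minus_one: "norm (exp (- 1) :: complex) < 1"
  by (simp add: norm_exp_eq_Re)

text \<open>Euler's expansion with M = n - 1. The tail of order n - 1 has n factors in each
  denominator, which accounts for the order x to the power - n.\<close>

lemma J_rem_eq:
  assumes "x \<in> slit_plane"
  shows "J_rem n x = (- exp (- 1) / (1 - exp (- 1))) ^ (n - 1) * lerch_tail (exp (- 1)) (n - 1) x"
  using lerch_phi_expansion[OF norm_exp_minus_one assms, of "n - 1"]
  unfolding J_rem_def J_int_eq[OF assms] sum_shift_pred J_term_Suc euler_term_def by simp

lemma K_rem_eq:
  assumes "x \<in> slit_plane"
  shows "K_rem k n x =
    - ((- K_base k / (1 - K_base k)) ^ (n - 1) * lerch_tail (K_base k) (n - 1) (2 ^ k * x))"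
  using lerch_phi_expansion[OF norm_K_base[of k] slit_plane_scale[OF assms, of k], of "n - 1"]
  unfolding K_rem_def K_int_eq[OF assms] sum_shift_pred K_term_Suc euler_term_def by simp

text \<open>The remainder is O(r ^ M M powr (- Re a)) with r < 1; the geometric factor wins even
  when Re a is negative.\<close>

lemma euler_term_sums:
  assumes z: "norm z < 1" and a: "a \<in> slit_plane" and q: "norm (- z / (1 - z)) < 1"
  shows "(\<lambda>m. euler_term z m a) sums lerch_phi z 1 a"
proof -
  define r where "r = norm (- z / (1 - z))"
  have "(\<lambda>M. r ^ M * real M powr (- Re a)) \<longlonglongrightarrow> 0"
  \<comment> \<open>The case r = 0 is separate because the asymptotic comparison writes r as exp (-
    s).\<close>
  proof (cases "r = 0")
    case True
    then show ?thesis
      by (intro tendsto_eventually eventually_mono[OF eventually_gt_at_top[of 0]]) auto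
  next
    case False
    define s where "s = - ln r"
    have s: "s > 0" using False q by (simp add: s_def r_def[symmetric]) (simp add: r_def)
    have r: "r = exp (- s)" using False by (simp add: s_def r_def)
    have "(\<lambda>M. exp (- s * real M) * real M powr (- Re a)) \<longlonglongrightarrow> 0"
      using s by real_asymp
    also have "(\<lambda>M. exp (- s * real M)) = (\<lambda>M. r ^ M)"
      by (simp add: r mult.commute flip: exp_of_nat_mult)
    finally show ?thesis .
  qed
  then have "(\<lambda>M. r ^ M * real M powr (- Re a)) \<in> o(\<lambda>_. 1)"
    by (intro smalloI_tendsto) auto
  moreover have "(\<lambda>M. r ^ M * norm (lerch_tail z M a)) \<in> O(\<lambda>M. r ^ M * real M powr (- Re a))"
    by (intro landau_o.big.mult lerch_tail_bigo z a) auto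
  ultimately have "(\<lambda>M. r ^ M * norm (lerch_tail z M a)) \<in> o(\<lambda>_. 1)"
    by (rule landau_o.big_small_trans[rotated])
  from smalloD_tendsto[OF this]
  have "(\<lambda>M. norm ((- z / (1 - z)) ^ M * lerch_tail z M a)) \<longlonglongrightarrow> 0"
    by (simp add: norm_mult norm_power r_def)
  from tendsto_diff[OF tendsto_const tendsto_norm_zero_cancel[OF this], of "lerch_phi z 1 a"]
  have "(\<lambda>M. lerch_phi z 1 a - (- z / (1 - z)) ^ M * lerch_tail z M a) \<longlonglongrightarrow> lerch_phi z 1 a"
    by simp
  moreover have "lerch_phi z 1 a - (- z / (1 - z)) ^ M * lerch_tail z M a =
      (\<Sum>m<M. euler_term z m a)" for M
    using lerch_phi_expansion[OF z a, of M] by (simp add: euler_term_def)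
  ultimately show ?thesis by (simp add: sums_def)
qed

text \<open>Replacing n - 1 by n costs the constant factor 1 / r in the power of r, and a factor
  tending to 1 in the power of n.\<close>

lemma remainder_bigo_fixed_point:
  assumes z: "norm z < 1" and a: "a \<in> slit_plane" and r: "r > 0"
  shows "(\<lambda>n. r ^ (n - 1) * norm (lerch_tail z (n - 1) a)) \<in> O(\<lambda>n. r ^ n * real n powr (- Re a))"
proof (rule landau_o.big.mult)
  have "(\<lambda>n. r ^ (n - 1)) \<in> \<Theta>(\<lambda>n. r ^ n / r)"
    using r by (intro bigthetaI_cong eventually_mono[OF eventually_gt_at_top[of 0]])
      (auto simp: power_eq_if)
  then show "(\<lambda>n. r ^ (n - 1)) \<in> O(\<lambda>n. r ^ n)"
    using r by auto
  have "filterlim (\<lambda>n::nat. n - 1) at_top at_top" by (rule filterlim_minus_const_nat_at_top)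
  from landau_o.big.compose[OF lerch_tail_bigo[OF z a] this]
  have "(\<lambda>n. norm (lerch_tail z (n - 1) a)) \<in> O(\<lambda>n. real (n - 1) powr (- Re a))" .
  also have "(\<lambda>n. real (n - 1) powr (- Re a)) \<in> \<Theta>(\<lambda>n. (real n - 1) powr (- Re a))"
    by (intro bigthetaI_cong eventually_mono[OF eventually_gt_at_top[of 0]])
       (simp add: of_nat_diff)
  also have "(\<lambda>n. (real n - 1) powr (- Re a)) \<in> O(\<lambda>n. real n powr (- Re a))"
    by real_asymp
  finally show "(\<lambda>n. norm (lerch_tail z (n - 1) a)) \<in> O(\<lambda>n. real n powr (- Re a))" .
qed

text \<open>In the sector, Re x \<ge> - cos \<delta> \<open>norm x\<close>, so
  \<open>norm_add_nonneg_ge\<close> applies with \<kappa> = cos \<delta>, and each of the m + 1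
  Pochhammer factors has modulus at least \<open>s * norm x\<close>.\<close>

lemma lerch_tail_bigo_sector:
  assumes z: "norm z < 1" and \<delta>: "\<delta> > 0" and N: "N \<ge> 1"
  shows "(\<lambda>x. lerch_tail z m (of_real N * x)) \<in> O[at_infinity_sector \<delta>](\<lambda>x. 1 / x ^ Suc m)"
proof -
  define s where "s = sqrt ((1 - cos \<delta>) / 2)"
  have "norm (lerch_tail z m (of_real N * x)) \<le> fact m / s ^ Suc m / (1 - norm z) * norm (1 / x ^ Suc m)"
    if x: "norm x \<ge> 1" "\<bar>Arg x\<bar> \<le> pi - \<delta>" for x
  proof -
    \<comment> \<open>A point in the sector forces \<delta> \<le> \<pi>; for larger \<delta> the
      sector is empty.\<close>
    have d: "\<delta> \<le> pi" using x(2) abs_ge_zero[of "Arg x"] by linarith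
    have "cos \<delta> < cos 0" using d \<delta> by (intro cos_monotone_0_pi) auto
    then have s: "s > 0" by (simp add: s_def)
    have "- cos \<delta> = cos (pi - \<delta>)" by simp
    also have "\<dots> \<le> cos \<bar>Arg x\<bar>" using d \<delta> x(2) by (intro cos_monotone_0_pi_le) auto
    finally have "- cos \<delta> \<le> cos (Arg x)" by simp
    then have "norm x * (- cos \<delta>) \<le> norm x * cos (Arg x)" by (intro mult_left_mono) auto
    also have "\<dots> = Re x" by (metis Re_rcis rcis_cmod_Arg)
    finally have Re: "- cos \<delta> * norm x \<le> Re x" by (simp add: mult.commute)
    have "s * norm x \<le> norm (of_real N * x + of_real t)" if t: "t \<ge> 0" for t
    proof -
      have "s * norm x \<le> N * (s * (norm x + t / N))"
      proof -
        have "1 * norm x \<le> N * norm x" using N by (intro mult_right_mono) auto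
        then have "s * norm x \<le> s * (N * norm x + t)"
          using s t by (intro mult_left_mono) auto
        also have "\<dots> = N * (s * (norm x + t / N))"
          using N by (simp add: distrib_left)
        finally show ?thesis .
      qed
      also have "\<dots> \<le> N * norm (x + of_real (t / N))"
        unfolding s_def using N t by (intro mult_left_mono norm_add_nonneg_ge Re) auto
      also have "\<dots> = norm (of_real N * (x + of_real (t / N)))"
        using N by (simp add: norm_mult)
      also have "of_real N * (x + of_real (t / N)) = of_real N * x + of_real t"
        using N by (simp add: distrib_left)
      finally show ?thesis .
    qed
    from norm_pochhammer_ge[OF _ this]
    have "norm (lerch_tail z m (of_real N * x)) \<le> fact m / (s * norm x) ^ Suc m / (1 - norm z)"
      using s x(1) by (intro lerch_tail_bound(2) z zero_less_power mult_pos_pos) (auto simp del: power_Suc)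
    also have "\<dots> = fact m / s ^ Suc m / (1 - norm z) * norm (1 / x ^ Suc m)"
      by (simp add: power_mult_distrib norm_divide norm_power norm_mult)
    finally show ?thesis .
  qed
  then show ?thesis
    unfolding at_infinity_sector_def
    by (intro bigoI[where c = "fact m / s ^ Suc m / (1 - norm z)"])
       (auto simp: eventually_inf_principal eventually_at_infinity)
qed

lemma bigo_const_mult:
  fixes c :: complex
  assumes "f \<in> O[F](g)"
  shows "(\<lambda>x. c * f x) \<in> O[F](g)"
  using landau_o.big.mult[OF bigo_const assms, of c] by simp

text \<open>The remainder formulas hold on the slit plane; this makes them available along the
  filter.\<close>

lemma eventually_sector_slit_plane:
  assumes "\<delta> > 0"
  shows "\<forall>\<^sub>F x in at_infinity_sector \<delta>. x \<in> slit_plane"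
proof -
  have "x \<in> slit_plane" if x: "norm x \<ge> 1" "\<bar>Arg x\<bar> \<le> pi - \<delta>" for x
  proof -
    have "Arg x \<noteq> pi" using x(2) assms by auto
    moreover have "x \<noteq> 0" using x(1) by auto
    ultimately show ?thesis
      by (auto simp: slit_plane_def Arg_eq_pi complex_nonpos_Reals_iff complex_eq_iff less_le)
  qed
  then show ?thesis
    unfolding at_infinity_sector_def
    by (auto simp: eventually_inf_principal eventually_at_infinity)
qed

theorem proposition8:
  shows
    "continues_integral f_integrand laplace_f \<and>
     continues_integral J_integrand J_int \<and>
     (\<forall>k\<ge>1. continues_integral (K_integrand k) (K_int k)) \<and>
     (\<forall>x\<in>slit_plane.
       summable (\<lambda>k. K_int (Suc k) x) \<and>
       laplace_f x = J_int x - (\<Sum>k. K_int (Suc k) x) \<and>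
       summable (\<lambda>k. lerch_phi (- exp (- (1 / 2 ^ Suc k))) 1 (2 ^ Suc k * x)) \<and>
       J_int x - (\<Sum>k. K_int (Suc k) x) =
         lerch_phi (exp (- 1)) 1 x
         - (\<Sum>k. lerch_phi (- exp (- (1 / 2 ^ Suc k))) 1 (2 ^ Suc k * x))) \<and>
     (\<forall>x\<in>slit_plane.
       summable (\<lambda>m. J_term (Suc m) x) \<and>
       (\<forall>k\<ge>1. summable (\<lambda>m. K_term k (Suc m) x)) \<and>
       summable (\<lambda>k. \<Sum>m. K_term (Suc k) (Suc m) x) \<and>
       laplace_f x = (\<Sum>m. J_term (Suc m) x) - (\<Sum>k. \<Sum>m. K_term (Suc k) (Suc m) x)) \<and>
     (\<forall>x\<in>slit_plane.
       (\<lambda>n. norm (J_rem n x)) \<in> O(\<lambda>n. 1 / (exp 1 - 1) ^ n * real n powr (- Re x))) \<and>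
     (\<forall>n\<ge>1. \<forall>\<delta>>0. J_rem n \<in> O[at_infinity_sector \<delta>](\<lambda>x. 1 / x ^ n)) \<and>
     (\<forall>x\<in>slit_plane. \<forall>k\<ge>1.
       (\<lambda>n. norm (K_rem k n x)) \<in>
         O(\<lambda>n. 1 / 2 ^ k * (1 / (1 + exp (1 / 2 ^ k)) ^ n) * real n powr (- (2 ^ k) * Re x))) \<and>
     (\<forall>k\<ge>1. \<forall>n\<ge>1. \<forall>\<delta>>0.
       K_rem k n \<in> O[at_infinity_sector \<delta>](\<lambda>x. 1 / (2 ^ k * x ^ n)))"
proof (intro conjI allI impI ballI)
  show "continues_integral f_integrand laplace_f"
    unfolding laplace_f_def by (rule continued_integral(1)[OF continues_f])
  show "continues_integral J_integrand J_int"
    unfolding J_int_def by (rule continued_integral(1)[OF continues_J])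
  show "continues_integral (K_integrand k) (K_int k)" for k
    unfolding K_int_def by (rule continued_integral(1)[OF continues_K])
next
  fix x assume x: "x \<in> slit_plane"
  have f: "laplace_f x = lerch_phi (exp (- 1)) 1 x - (\<Sum>k. lerch_phi (K_base (Suc k)) 1 (2 ^ Suc k * x))"
    unfolding laplace_f_def by (rule continued_integral(2)[OF continues_f x])
  show "summable (\<lambda>k. lerch_phi (- exp (- (1 / 2 ^ Suc k))) 1 (2 ^ Suc k * x))"
    by (rule summable_K[OF x])
  then show "summable (\<lambda>k. K_int (Suc k) x)"
    by (simp only: K_int_eq[OF x])
  show "laplace_f x = J_int x - (\<Sum>k. K_int (Suc k) x)"
    and "J_int x - (\<Sum>k. K_int (Suc k) x) = lerch_phi (exp (- 1)) 1 x
         - (\<Sum>k. lerch_phi (- exp (- (1 / 2 ^ Suc k))) 1 (2 ^ Suc k * x))"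
    by (simp_all only: f J_int_eq[OF x] K_int_eq[OF x])
  \<comment> \<open>This makes the Euler ratio 1 / (e - 1) of the J series less than 1. For K the
    ratio 1 / (1 + exp (1 / 2 ^ k)) is visibly less than 1.\<close>
  have "exp 1 > (2 :: real)" using exp_lower_Taylor_quadratic[of 1] by simp
  then have J: "(\<lambda>m. J_term (Suc m) x) sums lerch_phi (exp (- 1)) 1 x"
    unfolding J_term_Suc by (intro euler_term_sums norm_exp_minus_one x) (simp only: norm_ratio_J, simp)
  have K: "(\<lambda>m. K_term k (Suc m) x) sums lerch_phi (K_base k) 1 (2 ^ k * x)" for k
    unfolding K_term_Suc
    by (intro euler_term_sums norm_K_base slit_plane_scale x)
       (simp only: norm_ratio_K, simp add: add_pos_pos)
  show "summable (\<lambda>m. J_term (Suc m) x)" using J by (rule sums_summable)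
  show "summable (\<lambda>m. K_term k (Suc m) x)" for k using K by (rule sums_summable)
  show "summable (\<lambda>k. \<Sum>m. K_term (Suc k) (Suc m) x)"
    unfolding sums_unique[OF K, symmetric] by (rule summable_K[OF x])
  show "laplace_f x = (\<Sum>m. J_term (Suc m) x) - (\<Sum>k. \<Sum>m. K_term (Suc k) (Suc m) x)"
    unfolding sums_unique[OF K, symmetric] sums_unique[OF J, symmetric] by (rule f)
  have "(\<lambda>n. norm (J_rem n x)) =
      (\<lambda>n. (1 / (exp 1 - 1)) ^ (n - 1) * norm (lerch_tail (exp (- 1)) (n - 1) x))"
    by (simp only: J_rem_eq[OF x] norm_mult norm_power norm_ratio_J)
  then show "(\<lambda>n. norm (J_rem n x)) \<in> O(\<lambda>n. 1 / (exp 1 - 1) ^ n * real n powr (- Re x))"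
    using remainder_bigo_fixed_point[OF norm_exp_minus_one x, of "1 / (exp 1 - 1)"]
    by (simp add: power_one_over)
  fix k
  have "(\<lambda>n. norm (K_rem k n x)) =
      (\<lambda>n. (1 / (1 + exp (1 / 2 ^ k))) ^ (n - 1) * norm (lerch_tail (K_base k) (n - 1) (2 ^ k * x)))"
    by (simp only: K_rem_eq[OF x] norm_minus_cancel norm_mult norm_power norm_ratio_K)
  also have "\<dots> \<in> O(\<lambda>n. (1 / (1 + exp (1 / 2 ^ k))) ^ n * real n powr (- Re (2 ^ k * x)))"
    by (intro remainder_bigo_fixed_point norm_K_base slit_plane_scale x) (simp add: add_pos_pos)
  also have "(\<lambda>n. (1 / (1 + exp (1 / 2 ^ k))) ^ n * real n powr (- Re (2 ^ k * x))) \<in>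
      O(\<lambda>n. 1 / 2 ^ k * (1 / (1 + exp (1 / 2 ^ k)) ^ n) * real n powr (- (2 ^ k) * Re x))"
  proof -
    have "2 ^ k * x = of_real (2 ^ k) * x" by simp
    then have "Re (2 ^ k * x) = 2 ^ k * Re x"
      by (simp only: times_complex.sel Re_complex_of_real Im_complex_of_real)
    then show ?thesis
      \<comment> \<open>Here k is fixed, so the factor \<open>1 / 2 ^ k\<close> is paid for by the
        constant.\<close>
      by (intro bigoI[where c = "2 ^ k"]) (simp add: power_one_over)
  qed
  finally show "(\<lambda>n. norm (K_rem k n x)) \<in>
      O(\<lambda>n. 1 / 2 ^ k * (1 / (1 + exp (1 / 2 ^ k)) ^ n) * real n powr (- (2 ^ k) * Re x))" .
next
  fix n :: nat and \<delta> :: real assume n: "n \<ge> 1" and \<delta>: "\<delta> > 0"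
  have n1: "Suc (n - 1) = n" using n by simp
  note ev = eventually_sector_slit_plane[OF \<delta>]
  have "J_rem n \<in> \<Theta>[at_infinity_sector \<delta>](\<lambda>x. (- exp (- 1) / (1 - exp (- 1))) ^ (n - 1)
      * lerch_tail (exp (- 1)) (n - 1) (of_real 1 * x))"
    using ev by (intro bigthetaI_cong) (auto elim!: eventually_mono simp: J_rem_eq)
  also have "(\<lambda>x. (- exp (- 1) / (1 - exp (- 1))) ^ (n - 1)
      * lerch_tail (exp (- 1)) (n - 1) (of_real 1 * x)) \<in> O[at_infinity_sector \<delta>](\<lambda>x. 1 / x ^ n)"
    using lerch_tail_bigo_sector[OF norm_exp_minus_one \<delta>, of 1 "n - 1"]
    unfolding n1 by (intro bigo_const_mult) simp
  finally show "J_rem n \<in> O[at_infinity_sector \<delta>](\<lambda>x. 1 / x ^ n)" .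
  fix k
  have "K_rem k n \<in> \<Theta>[at_infinity_sector \<delta>](\<lambda>x. - ((- K_base k / (1 - K_base k)) ^ (n - 1))
      * lerch_tail (K_base k) (n - 1) (of_real (2 ^ k) * x))"
    using ev by (intro bigthetaI_cong) (auto elim!: eventually_mono simp: K_rem_eq)
  also have "(\<lambda>x. - ((- K_base k / (1 - K_base k)) ^ (n - 1))
      * lerch_tail (K_base k) (n - 1) (of_real (2 ^ k) * x)) \<in> O[at_infinity_sector \<delta>](\<lambda>x. 1 / x ^ n)"
    using lerch_tail_bigo_sector[OF norm_K_base[of k] \<delta>, of "2 ^ k" "n - 1"]
    unfolding n1 by (intro bigo_const_mult) simp
  also have "(\<lambda>x. 1 / x ^ n) \<in> O[at_infinity_sector \<delta>](\<lambda>x. 1 / (2 ^ k * x ^ n))"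
    by (intro bigoI[where c = "2 ^ k"]) (simp add: norm_divide norm_mult norm_power)
  finally show "K_rem k n \<in> O[at_infinity_sector \<delta>](\<lambda>x. 1 / (2 ^ k * x ^ n))" .
qed

end
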